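(* $C_2=11$. Consequently, $\mathrm{HGP}(B_{2,n})\le 11$ for every $n\ge 1$, and there is an integer $n_0$ with $$n_0\le \lceil 110(\log 2)\,9^7\rceil=364{,}683{,}163$$ ($\log$ the natural logarithm) such that $\mathrm{HGP}(B_{2,n})=11$ for every $n\ge n_0$. In particular, $$\lim_{n\to\infty}\mathrm{HGP}(B_{2,n})=\sup_{n\ge1}\mathrm{HGP}(B_{2,n})=11 .$$
   Context: Proper hat-guessing game: let $G=(V,E)$ be a finite simple graph and $[q]=\{0,1,\dots,q-1\}$. Before play, the vertices agree on deterministic guess functions; the guess of each vertex is a function of the colors on its open neighborhood, with values in $[q]$. An adversary assigns a color from $[q]$ to every vertex so that adjacent vertices get distinct colors (a proper $q$-coloring). All vertices simultaneously guess their own colors. A strategy (family of guess functions) is winning with $q$ colors if for every proper $q$-coloring at least one vertex guesses its own color correctly. The proper hat-guessing number $\mathrm{HGP}(G)$ is the largest $q$ for which a winning strategy exists. The book graph is $B_{k,n}=K_k\vee\overline{K_n}$ (join): $k$ mutually adjacent vertices (spines) and $n$ pairwise nonadjacent vertices (pages), every page adjacent to every spine. A proper $k$-tuple is a $k$-tuple $\boldsymbol{x}=(x_1,\dots,x_k)$ of pairwise distinct colors; a configuration is a set $P$ of proper $k$-tuples, with colors drawn from some finite set. Let $\pi_i(\boldsymbol{x})$ be the $(k-1)$-tuple obtained by deleting coordinate $i$. A set $A$ of proper $k$-tuples is $i$-saturated if $\pi_i$ restricted to $A$ is injective. A configuration $P$ is coverable if it can be partitioned as $P=P_1\,\dot\cup\cdots\dot\cup\,P_k$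 (parts may be empty) with $P_i$ being $i$-saturated for every $i$. Let $\mathrm{supp}(P)=\bigcup_{\boldsymbol{x}\in P}\{x_1,\dots,x_k\}$. Define $$C_k=\min\{|P|+|\mathrm{supp}(P)| : P \text{ is a finite non-coverable configuration of proper } k\text{-tuples}\},$$ where the colors may be drawn from any finite set. Here $k=2$. *)

theory Defs
  imports "HOL-Analysis.Analysis" "HOL-Library.Disjoint_Sets"
begin

text \<open>A graph is a pair of a vertex set and a set of two-element edges.\<close>

type_synonym 'v graph = "'v set \<times> 'v set set"

abbreviation verts :: "'v graph \<Rightarrow> 'v set" where "verts G \<equiv> fst G"
abbreviation edges :: "'v graph \<Rightarrow> 'v set set" where "edges G \<equiv> snd G"

definition fin_simple_graph :: "'v graph \<Rightarrow> bool" where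
  "fin_simple_graph G \<longleftrightarrow>
     finite (verts G) \<and> (\<forall>e\<in>edges G. e \<subseteq> verts G \<and> card e = 2)"

definition nbhd :: "'v graph \<Rightarrow> 'v \<Rightarrow> 'v set" where
  "nbhd G v = {u. {u, v} \<in> edges G}"

definition proper_colouring :: "'v graph \<Rightarrow> nat \<Rightarrow> ('v \<Rightarrow> nat) \<Rightarrow> bool" where
  "proper_colouring G q c \<longleftrightarrow>
     c \<in> verts G \<rightarrow> {..<q} \<and> (\<forall>u v. {u, v} \<in> edges G \<longrightarrow> c u \<noteq> c v)"

definition strategy :: "'v graph \<Rightarrow> nat \<Rightarrow> ('v \<Rightarrow> ('v \<Rightarrow> nat) \<Rightarrow> nat) \<Rightarrow> bool" where
  "strategy G q g \<longleftrightarrow> (\<forall>v\<in>verts G. g v \<in> (nbhd G v \<rightarrow>\<^sub>E {..<q}) \<rightarrow> {..<q})"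

definition winning :: "'v graph \<Rightarrow> nat \<Rightarrow> ('v \<Rightarrow> ('v \<Rightarrow> nat) \<Rightarrow> nat) \<Rightarrow> bool" where
  "winning G q g \<longleftrightarrow> strategy G q g \<and>
     (\<forall>c. proper_colouring G q c \<longrightarrow>
        (\<exists>v\<in>verts G. g v (restrict c (nbhd G v)) = c v))"

text \<open>The largest number of colours exists for every nonempty finite simple graph; see
  \<open>winning_HGP\<close> and \<open>winning_le_HGP\<close> below.\<close>

definition HGP :: "'v graph \<Rightarrow> nat" where
  "HGP G = (GREATEST q. \<exists>g. winning G q g)"

definition complete_graph :: "'v set \<Rightarrow> 'v graph" where
  "complete_graph V = (V, {{u, v} | u v. u \<in> V \<and> v \<in> V \<and> u \<noteq> v})"

definition edgeless_graph :: "'v set \<Rightarrow> 'v graph" where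
  "edgeless_graph V = (V, {})"

definition graph_join :: "'a graph \<Rightarrow> 'b graph \<Rightarrow> ('a + 'b) graph" where
  "graph_join G H = (verts G <+> verts H,
     (`) Inl ` edges G \<union> (`) Inr ` edges H \<union>
     {{Inl u, Inr v} | u v. u \<in> verts G \<and> v \<in> verts H})"

definition book_graph :: "nat \<Rightarrow> nat \<Rightarrow> (nat + nat) graph" where
  "book_graph k n = graph_join (complete_graph {..<k}) (edgeless_graph {..<n})"

text \<open>Tuples are lists, with coordinates numbered from 0. Since only finite configurations
  matter, taking the colours from \<^typ>\<open>nat\<close> covers colours from any finite set.\<close>

definition proper_tuple :: "nat \<Rightarrow> nat list \<Rightarrow> bool" where
  "proper_tuple k x \<longleftrightarrow> length x = k \<and> distinct x"

definition configuration :: "nat \<Rightarrow> nat list set \<Rightarrow> bool" where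
  "configuration k P \<longleftrightarrow> (\<forall>x\<in>P. proper_tuple k x)"

definition del_coord :: "nat \<Rightarrow> 'a list \<Rightarrow> 'a list" where
  "del_coord i x = take i x @ drop (Suc i) x"

definition saturated :: "nat \<Rightarrow> nat list set \<Rightarrow> bool" where
  "saturated i A \<longleftrightarrow> inj_on (del_coord i) A"

definition coverable :: "nat \<Rightarrow> nat list set \<Rightarrow> bool" where
  "coverable k P \<longleftrightarrow>
     (\<exists>Q. P = (\<Union>i<k. Q i) \<and> disjoint_family_on Q {..<k} \<and> (\<forall>i<k. saturated i (Q i)))"

definition supp :: "nat list set \<Rightarrow> nat set" where
  "supp P = (\<Union>x\<in>P. set x)"

definition C :: "nat \<Rightarrow> nat" where
  "C k = (LEAST m. \<exists>P. configuration k P \<and> finite P \<and> \<not> coverable k P \<and>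
                        m = card P + card (supp P))"

lemma winning_bound:
  assumes G: "fin_simple_graph G" and w: "winning G q g"
  shows "q < card (verts G) * Suc (card (verts G))"
proof (rule ccontr)
  assume "\<not> ?thesis"
  define V where "V = verts G"
  define n where "n = card V"
  define m where "m = Suc n"
  from \<open>\<not> ?thesis\<close> have q: "n * m \<le> q" by (simp add: V_def n_def m_def)
  have fin: "finite V" using G by (simp add: fin_simple_graph_def V_def)
  obtain h where h: "bij_betw h V {..<n}"
    using ex_bij_betw_finite_nat[OF fin] by (auto simp: n_def lessThan_atLeast0)
  define S where "S v = {h v * m ..< Suc (h v) * m}" for v
  have cS: "card (S v) = m" and fS: "finite (S v)" for v by (simp_all add: S_def)
  have Sdiv: "x div m = h v" if "x \<in> S v" for x v
    using that by (intro div_nat_eqI) (auto simp: S_def m_def algebra_simps)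
  have Sq: "x < q" if "x \<in> S v" "v \<in> V" for x v
  proof -
    have "Suc (h v) \<le> n" using bij_betwE[OF h] that(2) by (simp add: Suc_le_eq)
    then have "Suc (h v) * m \<le> n * m" by (rule mult_le_mono1)
    with that(1) q show ?thesis by (auto simp: S_def)
  qed
  define T where "T = PiE V S"
  have fT: "finite T" using fin fS by (auto simp: T_def intro: finite_PiE)
  have cT: "card T = m ^ n" using fin by (simp add: T_def card_PiE cS n_def)
  define bad where "bad v = {c \<in> T. g v (restrict c (nbhd G v)) = c v}" for v
  have e2: "u \<in> V \<and> v \<in> V \<and> u \<noteq> v" if "{u, v} \<in> edges G" for u v
    using G that by (force simp: fin_simple_graph_def V_def)
  have cbad: "card (bad v) \<le> m ^ (n - 1)" if v: "v \<in> V" for v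
  proof -
    have inj: "inj_on (\<lambda>c. restrict c (V - {v})) (bad v)"
    proof (rule inj_onI)
      fix c d assume cd: "c \<in> bad v" "d \<in> bad v"
        and eq: "restrict c (V - {v}) = restrict d (V - {v})"
      have E: "c u = d u" if "u \<in> V - {v}" for u
        using fun_cong[OF eq, of u] that by simp
      have "restrict c (nbhd G v) = restrict d (nbhd G v)"
        by (intro restrict_ext E) (use e2 in \<open>auto simp: nbhd_def\<close>)
      then have "c v = d v" using cd by (simp add: bad_def)
      with E have "c u = d u" if "u \<in> V" for u using that by (cases "u = v") auto
      then show "c = d" using cd by (intro PiE_ext[of c V S d]) (auto simp: bad_def T_def)
    qed
    have "card (bad v) \<le> card (PiE (V - {v}) S)"
      by (rule card_inj_on_le[OF inj]) (use fin fS in \<open>auto simp: bad_def T_def PiE_mem intro!: finite_PiE split: if_splits\<close>)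
    also have "\<dots> = m ^ (n - 1)" using fin v by (simp add: card_PiE cS n_def)
    finally show ?thesis .
  qed
  have "card (\<Union>v\<in>V. bad v) \<le> (\<Sum>v\<in>V. card (bad v))" by (rule card_UN_le[OF fin])
  also have "\<dots> \<le> n * m ^ (n - 1)" using sum_bounded_above[OF cbad] by (simp add: n_def)
  also have "\<dots> < m ^ n" by (cases n) (auto simp: m_def)
  finally have "\<not> T \<subseteq> (\<Union>v\<in>V. bad v)"
    using card_mono[of "\<Union>v\<in>V. bad v" T] fin fT cT by (auto simp: bad_def)
  then obtain c where c: "c \<in> T" "\<And>v. v \<in> V \<Longrightarrow> g v (restrict c (nbhd G v)) \<noteq> c v"
    by (auto simp: bad_def)
  have mem: "c v \<in> S v" if "v \<in> V" for v using c(1) that by (auto simp: T_def)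
  have "proper_colouring G q c"
    unfolding proper_colouring_def
  proof (intro conjI allI impI Pi_I)
    fix v assume "v \<in> verts G"
    then show "c v \<in> {..<q}" using Sq mem by (auto simp: V_def)
  next
    fix u v assume "{u, v} \<in> edges G"
    then have uv: "u \<in> V" "v \<in> V" "u \<noteq> v" using e2 by auto
    then have "h u \<noteq> h v" using h by (auto simp: bij_betw_def inj_on_def)
    then show "c u \<noteq> c v" using Sdiv[OF mem[OF uv(1)]] Sdiv[OF mem[OF uv(2)]] by auto
  qed
  with w c(2) show False by (auto simp: winning_def V_def)
qed

lemma winning_one:
  assumes "verts G \<noteq> {}"
  shows "winning G 1 (\<lambda>v x. 0)"
  using assms by (auto simp: winning_def strategy_def proper_colouring_def Pi_iff)

lemma winning_HGP:
  assumes "fin_simple_graph G" "verts G \<noteq> {}"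
  shows "\<exists>g. winning G (HGP G) g"
  unfolding HGP_def
  by (rule GreatestI_nat[where P = "\<lambda>q. \<exists>g. winning G q g"])
     (use winning_one[OF assms(2)] winning_bound[OF assms(1)] in \<open>auto intro: less_imp_le\<close>)

lemma winning_le_HGP:
  assumes "fin_simple_graph G" "winning G q g"
  shows "q \<le> HGP G"
  unfolding HGP_def
  by (rule Greatest_le_nat[where P = "\<lambda>q. \<exists>g. winning G q g"])
     (use assms winning_bound[OF assms(1)] in \<open>auto intro: less_imp_le\<close>)

lemma fin_simple_graph_book_graph: "fin_simple_graph (book_graph k n)"
  by (auto simp: fin_simple_graph_def book_graph_def graph_join_def complete_graph_def
      edgeless_graph_def card_insert_if)

end

theory Submission
  imports Defs
begin

text \<open>Once the pages are coloured and their guess functions fixed, the spines win against exactly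
  those sets of spine colourings that are coverable: part \<open>i\<close> of a cover consists of the colourings
  on which spine \<open>i\<close> guesses right. If more than \<open>|P| + |supp P|\<close> colours are available for a
  non-coverable \<open>P\<close>, the adversary gives every page a colour outside \<open>supp P\<close> that the page does not
  guess on any element of \<open>P\<close>, so the spines face all of \<open>P\<close>. Conversely, with
  \<open>q \<le> |P| + |supp P|\<close> colours a page can exclude \<open>P\<close> by guessing every colour outside
  \<open>supp P\<close> somewhere on \<open>P\<close>. A random page does so with probability at least \<open>9\<^sup>-\<^sup>7\<close> (for
  \<open>k = 2\<close>, \<open>q = 11\<close>), so enough pages exclude all of the fewer than \<open>2\<^sup>1\<^sup>1\<^sup>0\<close> non-coverable
  configurations.

  For \<open>k = 2\<close>, a configuration is a bipartite graph between first and second coordinates, and a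
  minimal non-coverable one has minimum degree 2. With at most 6 edges it must then be a
  complete bipartite graph with parts of sizes 2 and 3, and those parts are disjoint since no pair has equal entries.\<close>

section \<open>Coverable configurations\<close>

lemma del_coord_eq_iff:
  assumes "length x = length y" "i < length x"
  shows "del_coord i x = del_coord i y \<longleftrightarrow> (\<forall>j<length x. j \<noteq> i \<longrightarrow> x ! j = y ! j)"
proof -
  have "del_coord i x = del_coord i y \<longleftrightarrow> take i x = take i y \<and> drop (Suc i) x = drop (Suc i) y"
    using assms by (simp add: del_coord_def)
  also have "\<dots> \<longleftrightarrow> (\<forall>j<i. x ! j = y ! j) \<and> (\<forall>j<length x - Suc i. x ! (Suc i + j) = y ! (Suc i + j))"
    using assms by (simp add: list_eq_iff_nth_eq)
  also have "(\<forall>j<length x - Suc i. x ! (Suc i + j) = y ! (Suc i + j))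
      \<longleftrightarrow> (\<forall>j<length x. i < j \<longrightarrow> x ! j = y ! j)" (is "?L \<longleftrightarrow> ?R")
  proof
    assume L: ?L
    show ?R
    proof (intro allI impI)
      fix j assume "j < length x" "i < j"
      with L[rule_format, of "j - Suc i"] show "x ! j = y ! j" by simp
    qed
  qed auto
  finally show ?thesis using assms by (auto simp: nat_neq_iff)
qed

lemma saturated_subset: "saturated i A \<Longrightarrow> B \<subseteq> A \<Longrightarrow> saturated i B"
  unfolding saturated_def by (rule inj_on_subset)

text \<open>Saturation passes to subsets, so overlapping parts can be made disjoint and cut down to
  P. Covers can thus be built without checking disjointness.\<close>

lemma coverable_iff: "coverable k P \<longleftrightarrow> (\<exists>Q. P \<subseteq> (\<Union>i<k. Q i) \<and> (\<forall>i<k. saturated i (Q i)))"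
proof
  assume "\<exists>Q. P \<subseteq> (\<Union>i<k. Q i) \<and> (\<forall>i<k. saturated i (Q i))"
  then obtain Q where Q: "P \<subseteq> (\<Union>i<k. Q i)" "\<And>i. i < k \<Longrightarrow> saturated i (Q i)" by blast
  let ?R = "disjointed (\<lambda>i. Q i \<inter> P)"
  have "(\<Union>i<k. ?R i) = P"
    using finite_UN_disjointed_eq[of "\<lambda>i. Q i \<inter> P" k] Q(1) by (auto simp: lessThan_atLeast0)
  moreover have "disjoint_family_on ?R {..<k}"
    using disjoint_family_disjointed by (rule disjoint_family_on_mono[rotated]) simp
  moreover have "saturated i (?R i)" if "i < k" for i
    using disjointed_subset[of "\<lambda>i. Q i \<inter> P" i] by (intro saturated_subset[OF Q(2)[OF that]]) auto
  ultimately show "coverable k P" unfolding coverable_def by (intro exI[of _ ?R]) auto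
qed (unfold coverable_def, blast)

lemma coverable_subset: "coverable k P \<Longrightarrow> P' \<subseteq> P \<Longrightarrow> coverable k P'"
  unfolding coverable_iff by (meson order_trans)

text \<open>Part i of a cover is mapped injectively by \<open>del_coord i\<close> into the
  projection of P. This counting obstruction later shows that \<open>K23\<close> is not
  coverable.\<close>

lemma coverable_card_le:
  assumes "coverable k P" "finite P"
  shows "card P \<le> (\<Sum>i<k. card (del_coord i ` P))"
proof -
  obtain Q where Q: "P = (\<Union>i<k. Q i)" "\<And>i. i < k \<Longrightarrow> saturated i (Q i)"
    using assms(1) unfolding coverable_def by blast
  have "card P \<le> (\<Sum>i<k. card (Q i))" unfolding Q(1) by (rule card_UN_le) simp
  also have "\<dots> \<le> (\<Sum>i<k. card (del_coord i ` P))"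
  proof (rule sum_mono)
    fix i assume "i \<in> {..<k}"
    with Q have "card (Q i) = card (del_coord i ` Q i)" by (simp add: saturated_def card_image)
    also have "\<dots> \<le> card (del_coord i ` P)"
      using \<open>i \<in> {..<k}\<close> Q(1) assms(2) by (intro card_mono) auto
    finally show "card (Q i) \<le> card (del_coord i ` P)" .
  qed
  finally show ?thesis .
qed

text \<open>Since x shares its i-th projection with no other tuple of P, it can join part i without
  destroying i-saturation.\<close>

lemma coverable_remove:
  assumes "coverable k (P - {x})" "i < k" "del_coord i x \<notin> del_coord i ` (P - {x})"
  shows "coverable k P"
proof -
  obtain Q where Q: "P - {x} = (\<Union>i<k. Q i)" "\<And>i. i < k \<Longrightarrow> saturated i (Q i)"
    using assms(1) unfolding coverable_def by blast
  let ?R = "Q(i := insert x (Q i))"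
  have "P \<subseteq> (\<Union>j<k. ?R j)"
  proof
    fix z assume "z \<in> P"
    show "z \<in> (\<Union>j<k. ?R j)"
    proof (cases "z = x")
      case True with assms(2) show ?thesis by (auto intro!: bexI[of _ i])
    next
      case False
      with \<open>z \<in> P\<close> have "z \<in> (\<Union>i<k. Q i)" using Q(1) by blast
      then show ?thesis by auto
    qed
  qed
  moreover have "saturated j (?R j)" if "j < k" for j
  proof (cases "j = i")
    case True
    have "Q i \<subseteq> P - {x}" using Q(1) assms(2) by blast
    then have "del_coord i x \<notin> del_coord i ` Q i" using assms(3) by blast
    with Q(2)[OF assms(2)] True show ?thesis by (auto simp: saturated_def inj_on_insert)
  qed (use Q(2) that in simp)
  ultimately show ?thesis unfolding coverable_iff by blast
qed

lemma not_coverable_minimal: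
  assumes "finite P" "\<not> coverable k P"
  obtains P' where "P' \<subseteq> P" "\<not> coverable k P'" "\<And>x. x \<in> P' \<Longrightarrow> coverable k (P' - {x})"
proof -
  define \<F> where "\<F> = {P'. P' \<subseteq> P \<and> \<not> coverable k P'}"
  have "finite \<F>" "P \<in> \<F>" using assms by (auto simp: \<F>_def)
  then obtain P' where P': "P' \<in> \<F>" "\<And>R. R \<in> \<F> \<Longrightarrow> R \<subseteq> P' \<Longrightarrow> R = P'"
    using finite_has_minimal2[of \<F> P] by blast
  have "coverable k (P' - {x})" if "x \<in> P'" for x
    using P'(2)[of "P' - {x}"] P'(1) that by (auto simp: \<F>_def)
  with P'(1) show ?thesis by (intro that[of P']) (auto simp: \<F>_def)
qed

lemma coverable_min_degree:
  assumes "\<not> coverable k P" "\<And>x. x \<in> P \<Longrightarrow> coverable k (P - {x})" "x \<in> P" "i < k"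
  obtains y where "y \<in> P" "y \<noteq> x" "del_coord i y = del_coord i x"
  using coverable_remove[OF assms(2)[OF assms(3)] assms(4)] assms(1) by fastforce

section \<open>Sets of ordered pairs\<close>

text \<open>E is read as the edge set of a bipartite graph, first entries on one side and second
  entries on the other; a colour used in both positions counts as two vertices.\<close>

definition pair_tuples :: "('a \<times> 'a) set \<Rightarrow> 'a list set" where
  "pair_tuples E = (\<lambda>(a, b). [a, b]) ` E"

lemma mem_pair_tuples [simp]: "[a, b] \<in> pair_tuples E \<longleftrightarrow> (a, b) \<in> E"
  by (force simp: pair_tuples_def)

lemma pair_tuplesE:
  assumes "x \<in> pair_tuples E"
  obtains a b where "x = [a, b]" "(a, b) \<in> E"
  using assms by (auto simp: pair_tuples_def)

lemma card_pair_tuples: "card (pair_tuples E) = card E"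
  unfolding pair_tuples_def by (rule card_image) (auto simp: inj_on_def)

lemma supp_pair_tuples: "supp (pair_tuples E) = fst ` E \<union> snd ` E"
  by (force simp: supp_def pair_tuples_def)

lemma del_coord_pair [simp]: "del_coord 0 [a, b] = [b]" "del_coord (Suc 0) [a, b] = [a]"
  by (simp_all add: del_coord_def)

lemma configuration_2_pairs:
  assumes "configuration 2 P"
  obtains E where "P = pair_tuples E" "\<And>a. (a, a) \<notin> E"
proof
  let ?E = "{(a, b). [a, b] \<in> P}"
  have "\<exists>a b. x = [a, b]" if "x \<in> P" for x
    using assms that by (auto simp: configuration_def proper_tuple_def length_Suc_conv numeral_2_eq_2)
  then show "P = pair_tuples ?E" by (fastforce simp: pair_tuples_def)
  show "(a, a) \<notin> ?E" for a
    using assms by (auto simp: configuration_def proper_tuple_def)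
qed

text \<open>A cover assigns each edge to one of its endpoints, no vertex receiving two edges.
  Deleting coordinate 0 leaves the second entry, so W, injective in \<open>snd\<close>, is part 0
  and U is part 1.\<close>

lemma coverable_2I:
  assumes "E \<subseteq> U \<union> W" "inj_on fst U" "inj_on snd W"
  shows "coverable 2 (pair_tuples E)"
  unfolding coverable_iff
proof (intro exI conjI allI impI)
  let ?Q = "\<lambda>i::nat. if i = 0 then pair_tuples W else pair_tuples U"
  show "pair_tuples E \<subseteq> (\<Union>i<2. ?Q i)"
    using assms(1) by (auto simp: pair_tuples_def numeral_2_eq_2 lessThan_Suc)
  show "saturated i (?Q i)" if "i < 2" for i
    using assms(2,3) that
    by (force simp: saturated_def inj_on_def pair_tuples_def less_2_cases_iff)
qed

section \<open>Bipartite graphs with at most six edges\<close>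

lemma card_ge_2I: "finite A \<Longrightarrow> a \<in> A \<Longrightarrow> b \<in> A \<Longrightarrow> a \<noteq> b \<Longrightarrow> 2 \<le> card A"
  using card_mono[of A "{a, b}"] by auto

lemma card_ge_twice_image:
  assumes "finite E" "\<And>x. x \<in> E \<Longrightarrow> \<exists>y\<in>E. y \<noteq> x \<and> f y = f x"
  shows "2 * card (f ` E) \<le> card E"
proof -
  have "2 * card (f ` E) = (\<Sum>a\<in>f ` E. 2)" by simp
  also have "\<dots> \<le> (\<Sum>a\<in>f ` E. card {x \<in> E. f x = a})"
  proof (rule sum_mono)
    fix a assume "a \<in> f ` E"
    then obtain x where "x \<in> E" "f x = a" by blast
    with assms(2)[of x] assms(1) show "2 \<le> card {x \<in> E. f x = a}"
      by (auto intro: card_ge_2I[of _ x])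
  qed
  also have "\<dots> = card E"
    using sum.image_gen[OF assms(1), of "\<lambda>_. 1::nat" f] by (simp only: card_eq_sum)
  finally show ?thesis .
qed

text \<open>The complement of \<open>E\<close> in \<open>A \<times> B\<close> is a perfect matching, so \<open>E\<close> is a hexagon
  and splits into two perfect matchings.\<close>

lemma coverable_hexagon:
  assumes E: "E \<subseteq> A \<times> B" and AB: "card A = 3" "card B = 3" and cE: "card E = 6"
    and degA: "\<And>a b. (a, b) \<in> E \<Longrightarrow> \<exists>b'. (a, b') \<in> E \<and> b' \<noteq> b"
    and degB: "\<And>a b. (a, b) \<in> E \<Longrightarrow> \<exists>a'. (a', b) \<in> E \<and> a' \<noteq> a"
    and sur: "A = fst ` E" "B = snd ` E"
  shows "coverable 2 (pair_tuples E)"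
proof -
  define M where "M = A \<times> B - E"
  have fin: "finite A" "finite B" using AB by (auto intro: card_ge_0_finite)
  have finE: "finite E" using cE by (auto intro: card_ge_0_finite)
  have cM: "card M = 3"
    unfolding M_def using card_Diff_subset[OF finE E] AB cE by (simp add: card_cartesian_product)
  have fst_M: "inj_on fst M"
  proof (rule inj_onI, rule ccontr)
    fix x y assume xy: "x \<in> M" "y \<in> M" "fst x = fst y" "x \<noteq> y"
    obtain a b b' where [simp]: "x = (a, b)" "y = (a, b')" using xy(3) by (metis prod.collapse)
    have "a \<in> A" using xy by (auto simp: M_def)
    then obtain c where c: "(a, c) \<in> E" using sur by force
    then obtain c' where c': "(a, c') \<in> E" "c' \<noteq> c" using degA[OF c] by blast
    \<comment> \<open>Two non-neighbours b, b' and two neighbours c, c' of a would be four elements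
      of B.\<close>
    have "card {b, b', c, c'} = 4" using xy c c' by (auto simp: M_def card_insert_if)
    moreover have "{b, b', c, c'} \<subseteq> B" using xy c c' E by (auto simp: M_def)
    ultimately have "4 \<le> card B" by (metis card_mono fin(2))
    with AB show False by simp
  qed
  have snd_M: "inj_on snd M"
  proof (rule inj_onI, rule ccontr)
    fix x y assume xy: "x \<in> M" "y \<in> M" "snd x = snd y" "x \<noteq> y"
    obtain a b b' where [simp]: "x = (b, a)" "y = (b', a)" using xy(3) by (metis prod.collapse)
    have "a \<in> B" using xy by (auto simp: M_def)
    then obtain c where c: "(c, a) \<in> E" using sur by force
    then obtain c' where c': "(c', a) \<in> E" "c' \<noteq> c" using degB[OF c] by blast
    have "card {b, b', c, c'} = 4" using xy c c' by (auto simp: M_def card_insert_if)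
    moreover have "{b, b', c, c'} \<subseteq> A" using xy c c' E by (auto simp: M_def)
    ultimately have "4 \<le> card A" by (metis card_mono fin(1))
    with AB show False by simp
  qed
  obtain m1 m2 m3 where M: "M = {m1, m2, m3}" "m1 \<noteq> m2" "m1 \<noteq> m3" "m2 \<noteq> m3"
    using cM by (auto simp: card_3_iff)
  obtain a1 b1 a2 b2 a3 b3 where m: "m1 = (a1, b1)" "m2 = (a2, b2)" "m3 = (a3, b3)"
    by (metis prod.exhaust)
  have "fst ` M \<subseteq> A" "snd ` M \<subseteq> B" by (auto simp: M_def)
  then have "fst ` M = A" "snd ` M = B"
    using fin AB card_image[OF fst_M] card_image[OF snd_M] cM by (simp_all add: card_subset_eq)
  then have A: "A = {a1, a2, a3}" and B: "B = {b1, b2, b3}" by (auto simp: M m)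
  have d: "a1 \<noteq> a2" "a1 \<noteq> a3" "a2 \<noteq> a3" "b1 \<noteq> b2" "b1 \<noteq> b3" "b2 \<noteq> b3"
    using AB unfolding A B by (auto simp: card_insert_if split: if_splits)
  have "E = A \<times> B - M" using E by (auto simp: M_def)
  then have "E \<subseteq> {(a1, b2), (a2, b3), (a3, b1)} \<union> {(a2, b1), (a3, b2), (a1, b3)}"
    by (auto simp: A B M m)
  then show ?thesis by (rule coverable_2I) (use d in \<open>auto simp: inj_on_def\<close>)
qed

lemma coverable_square:
  assumes "E \<subseteq> A \<times> B" "card A = 2" "card B = 2"
  shows "coverable 2 (pair_tuples E)"
proof -
  obtain a a' b b' where "A = {a, a'}" "a \<noteq> a'" "B = {b, b'}" "b \<noteq> b'"
    using assms(2,3) by (auto simp: card_2_iff)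
  with assms(1) show ?thesis
    by (intro coverable_2I[of E "{(a, b), (a', b')}" "{(a, b'), (a', b)}"]) (auto simp: inj_on_def)
qed

text \<open>Minimality gives every vertex degree at least 2, so with at most 6 edges each side has 2
  or 3 vertices. The cases 2 x 2 and 3 x 3 are coverable, which leaves 2 x 3.\<close>

lemma not_coverable_small:
  assumes P: "configuration 2 P" "finite P" "\<not> coverable 2 P" "card P \<le> 6"
    and min: "\<And>x. x \<in> P \<Longrightarrow> coverable 2 (P - {x})"
  shows "card P = 6 \<and> card (supp P) = 5"
proof -
  obtain E where E: "P = pair_tuples E" and irr: "\<And>a. (a, a) \<notin> E"
    using configuration_2_pairs[OF P(1)] by blast
  have finE: "finite E"
    using P(2) unfolding E pair_tuples_def by (rule finite_imageD) (auto simp: inj_on_def)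
  have degA: "\<exists>b'. (a, b') \<in> E \<and> b' \<noteq> b" if ab: "(a, b) \<in> E" for a b
  proof -
    have p: "[a, b] \<in> P" using ab by (simp add: E)
    obtain y where y: "y \<in> P" "y \<noteq> [a, b]" "del_coord (Suc 0) y = del_coord (Suc 0) [a, b]"
      by (rule coverable_min_degree[OF P(3) min p, of "Suc 0"]) (assumption, simp, blast)
    obtain a' b' where "y = [a', b']" using y(1) E pair_tuplesE by blast
    with y E show ?thesis by auto
  qed
  have degB: "\<exists>a'. (a', b) \<in> E \<and> a' \<noteq> a" if ab: "(a, b) \<in> E" for a b
  proof -
    have p: "[a, b] \<in> P" using ab by (simp add: E)
    obtain y where y: "y \<in> P" "y \<noteq> [a, b]" "del_coord 0 y = del_coord 0 [a, b]"
      by (rule coverable_min_degree[OF P(3) min p, of "0"]) (assumption, simp, blast)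
    obtain a' b' where "y = [a', b']" using y(1) E pair_tuplesE by blast
    with y E show ?thesis by auto
  qed
  define A B where "A = fst ` E" and "B = snd ` E"
  have fin: "finite A" "finite B" and sub: "E \<subseteq> A \<times> B"
    using finE by (auto simp: A_def B_def image_iff) force+
  have cE: "card E \<le> 6" using P(4) by (simp add: E card_pair_tuples)
  have "2 * card A \<le> card E" "2 * card B \<le> card E"
    using card_ge_twice_image[OF finE, of fst] card_ge_twice_image[OF finE, of snd] degA degB
    by (fastforce simp: A_def B_def)+
  with cE have le3: "card A \<le> 3" "card B \<le> 3" by auto
  have "E \<noteq> {}"
    using coverable_2I[of E "{}" "{}"] P(3) E by auto
  then obtain a b where ab: "(a, b) \<in> E" by auto
  obtain a' b' where "(a', b) \<in> E" "a' \<noteq> a" "(a, b') \<in> E" "b' \<noteq> b"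
    using degA[OF ab] degB[OF ab] by blast
  with ab sub have ge2: "2 \<le> card A" "2 \<le> card B"
    by (auto intro: card_ge_2I[OF fin(1), of a a'] card_ge_2I[OF fin(2), of b b'])
  \<comment> \<open>A vertex facing a side of size 2 has two neighbours there, hence is adjacent to
    the whole side.\<close>
  have complete: "E = A \<times> B" if "card A = 2 \<or> card B = 2"
  proof (intro equalityI sub subsetI)
    fix z assume z: "z \<in> A \<times> B"
    obtain a b where [simp]: "z = (a, b)" by (cases z)
    show "z \<in> E"
    proof (cases "card A = 2")
      case True
      obtain c where c: "(c, b) \<in> E" using z by (force simp: B_def)
      then obtain c' where c': "(c', b) \<in> E" "c' \<noteq> c" using degB[OF c] by blast
      have "{c, c'} = A" using True c c' sub fin by (intro card_subset_eq) auto
      then show ?thesis using z c c' by auto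
    next
      case False
      with that have "card B = 2" by simp
      obtain c where c: "(a, c) \<in> E" using z by (force simp: A_def)
      then obtain c' where c': "(a, c') \<in> E" "c' \<noteq> c" using degA[OF c] by blast
      have "{c, c'} = B" using \<open>card B = 2\<close> c c' sub fin by (intro card_subset_eq) auto
      then show ?thesis using z c c' by auto
    qed
  qed
  have not22: "\<not> (card A = 2 \<and> card B = 2)"
    using coverable_square[OF sub] P(3) E by blast
  have not33: "\<not> (card A = 3 \<and> card B = 3)"
  proof
    assume 33: "card A = 3 \<and> card B = 3"
    with cE \<open>2 * card A \<le> card E\<close> have "card E = 6" by simp
    with 33 coverable_hexagon[OF sub _ _ _ degA degB A_def B_def] P(3) E show False by blast
  qed
  from ge2 le3 not22 not33 have c23: "card A + card B = 5" "card A * card B = 6" "card A = 2 \<or> card B = 2"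
    by (auto simp: le_Suc_eq numeral_eq_Suc)
  have EAB: "E = A \<times> B" using complete c23(3) .
  have "A \<inter> B = {}" using irr EAB by blast
  then have "card (supp P) = 5"
    using c23(1) fin by (simp add: E supp_pair_tuples card_Un_disjoint flip: A_def B_def)
  moreover have "card P = 6" using c23(2) EAB by (simp add: E card_pair_tuples card_cartesian_product)
  ultimately show ?thesis by simp
qed

section \<open>The value of \<open>C 2\<close>\<close>

lemma card_configuration_2_le:
  assumes "configuration 2 P" "finite P"
  shows "card P \<le> card (supp P) * (card (supp P) - 1)"
proof -
  define S where "S = supp P"
  have fS: "finite S" using assms by (auto simp: S_def supp_def)
  have "P \<subseteq> {x. length x = 2 \<and> distinct x \<and> set x \<subseteq> S}"
    using assms by (auto simp: configuration_def proper_tuple_def S_def supp_def)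
  moreover have "finite {x. length x = 2 \<and> distinct x \<and> set x \<subseteq> S}"
    by (rule finite_subset[OF _ finite_lists_length_eq[OF fS, of 2]]) auto
  ultimately have le: "card P \<le> card {x. length x = 2 \<and> distinct x \<and> set x \<subseteq> S}"
    by (rule card_mono[rotated])
  obtain E where E: "P = pair_tuples E" "\<And>a. (a, a) \<notin> E" using configuration_2_pairs[OF assms(1)] by blast
  show ?thesis
  proof (cases "card S \<ge> 2")
    case True
    then have "{card S - 2 + 1..card S} = {card S - 1, card S}" by auto
    with card_lists_distinct_length_eq[OF fS True] le True show ?thesis
      by (simp add: S_def mult.commute)
  next
    case False
    have "(a, b) \<notin> E" for a b
      using False E(2)[of a] card_ge_2I[OF fS, of a b]
      by (force simp: S_def E(1) supp_pair_tuples)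
    then have "E = {}" by auto
    then show ?thesis by (simp add: E pair_tuples_def)
  qed
qed

text \<open>The second bound is the lower bound on \<open>C 2\<close>; the first will limit to 7 =
  11 - 4 the colours that a page has to guess. Both are proved for a minimal R and pass to P by
  monotonicity.\<close>

lemma not_coverable_2_bounds:
  assumes "configuration 2 P" "finite P" "\<not> coverable 2 P"
  shows "4 \<le> card (supp P)" "11 \<le> card P + card (supp P)"
proof -
  obtain R where R: "R \<subseteq> P" "\<not> coverable 2 R" "\<And>x. x \<in> R \<Longrightarrow> coverable 2 (R - {x})"
    using not_coverable_minimal[OF assms(2,3)] by metis
  have fin: "finite R" "finite (supp P)"
    using R(1) assms(2) finite_subset by (auto simp: supp_def)
  have conf: "configuration 2 R" using assms(1) R(1) by (auto simp: configuration_def)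
  have "card R \<le> card P" "card (supp R) \<le> card (supp P)"
    using R(1) assms(2) fin(2) by (auto intro!: card_mono simp: supp_def)
  moreover have "4 \<le> card (supp R) \<and> 11 \<le> card R + card (supp R)"
  proof (cases "card R \<le> 6")
    case True
    with not_coverable_small[OF conf fin(1) R(2) True R(3)] show ?thesis by simp
  next
    case False
    \<comment> \<open>Three colours give only 3 * 2 = 6 ordered pairs, so seven pairs need a fourth
      colour, and 7 + 4 = 11.\<close>
    have "card (supp R) \<ge> 4"
    proof (rule ccontr)
      assume "\<not> ?thesis"
      then have "card (supp R) * (card (supp R) - 1) \<le> 3 * 2" by (intro mult_le_mono) auto
      with False card_configuration_2_le[OF conf fin(1)] show False by simp
    qed
    with False show ?thesis by simp
  qed
  ultimately show "4 \<le> card (supp P)" "11 \<le> card P + card (supp P)" by auto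
qed

definition K23 :: "nat list set" where
  "K23 = pair_tuples ({0, 1} \<times> {2, 3, 4})"

lemma K23:
  shows configuration_K23: "configuration 2 K23" and finite_K23: "finite K23"
    and not_coverable_K23: "\<not> coverable 2 K23"
    and card_K23: "card K23 = 6" and supp_K23: "supp K23 = {0, 1, 2, 3, 4}"
proof -
  show "configuration 2 K23" by (auto simp: K23_def pair_tuples_def configuration_def proper_tuple_def)
  show fin: "finite K23" by (simp add: K23_def pair_tuples_def)
  show c: "card K23 = 6" by (simp add: K23_def card_pair_tuples card_cartesian_product)
  show "supp K23 = {0, 1, 2, 3, 4}" by (auto simp: K23_def supp_pair_tuples)
  have "del_coord 0 ` K23 = {[2], [3], [4]}" "del_coord (Suc 0) ` K23 = {[0], [1]}"
    by (auto simp: K23_def pair_tuples_def image_image image_iff)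
  \<comment> \<open>If coverable, this set would have at most 3 + 2 elements, but it has 6.\<close>
  then show "\<not> coverable 2 K23"
    using coverable_card_le[OF _ fin, of 2] c by (auto simp: numeral_2_eq_2 lessThan_Suc)
qed

lemma C_2: "C 2 = 11"
  unfolding C_def
proof (rule Least_equality)
  show "\<exists>P. configuration 2 P \<and> finite P \<and> \<not> coverable 2 P \<and> 11 = card P + card (supp P)"
    using K23 by (intro exI[of _ K23]) simp
qed (use not_coverable_2_bounds in auto)

section \<open>Strategies on book graphs\<close>

lemma verts_book_graph: "verts (book_graph k n) = {..<k} <+> {..<n}"
  by (simp add: book_graph_def graph_join_def complete_graph_def edgeless_graph_def)

lemma edges_book_graph:
  "{Inl i, Inl j} \<in> edges (book_graph k n) \<longleftrightarrow> i < k \<and> j < k \<and> i \<noteq> j"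
  "{Inl i, Inr b} \<in> edges (book_graph k n) \<longleftrightarrow> i < k \<and> b < n"
  "{Inr b, Inl i} \<in> edges (book_graph k n) \<longleftrightarrow> i < k \<and> b < n"
  "{Inr b, Inr d} \<notin> edges (book_graph k n)"
proof -
  have "h ` {e. \<exists>u v. e = {u, v} \<and> P u v} = {e. \<exists>u v. e = h {u, v} \<and> P u v}"
    for h :: "nat set \<Rightarrow> (nat + nat) set" and P
    by blast
  then have E: "edges (book_graph k n) =
      {e. \<exists>i j. e = {Inl i, Inl j} \<and> i < k \<and> j < k \<and> i \<noteq> j} \<union> {e. \<exists>i b. e = {Inl i, Inr b} \<and> i < k \<and> b < n}"
    by (simp add: book_graph_def graph_join_def complete_graph_def edgeless_graph_def)
  show "{Inl i, Inl j} \<in> edges (book_graph k n) \<longleftrightarrow> i < k \<and> j < k \<and> i \<noteq> j"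
    "{Inl i, Inr b} \<in> edges (book_graph k n) \<longleftrightarrow> i < k \<and> b < n"
    "{Inr b, Inl i} \<in> edges (book_graph k n) \<longleftrightarrow> i < k \<and> b < n"
    "{Inr b, Inr d} \<notin> edges (book_graph k n)"
    unfolding E Un_iff mem_Collect_eq doubleton_eq_iff by auto
qed

lemma nbhd_book_graph_Inl:
  "i < k \<Longrightarrow> nbhd (book_graph k n) (Inl i) = Inl ` ({..<k} - {i}) \<union> Inr ` {..<n}"
  by (rule set_eqI, rename_tac u, case_tac u) (auto simp: nbhd_def edges_book_graph)

lemma nbhd_book_graph_Inr:
  "b < n \<Longrightarrow> nbhd (book_graph k n) (Inr b) = Inl ` {..<k}"
  by (rule set_eqI, rename_tac u, case_tac u) (auto simp: nbhd_def edges_book_graph)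

lemma proper_colouring_book_graph:
  "proper_colouring (book_graph k n) q c \<longleftrightarrow>
     (\<forall>i<k. c (Inl i) < q) \<and> (\<forall>b<n. c (Inr b) < q) \<and>
     (\<forall>i<k. \<forall>j<k. i \<noteq> j \<longrightarrow> c (Inl i) \<noteq> c (Inl j)) \<and>
     (\<forall>i<k. \<forall>b<n. c (Inl i) \<noteq> c (Inr b))"
proof -
  have all_sum: "(\<forall>u. Q u) \<longleftrightarrow> (\<forall>a. Q (Inl a)) \<and> (\<forall>b. Q (Inr b))" for Q :: "nat + nat \<Rightarrow> bool"
    by (metis sum.exhaust)
  show ?thesis
    unfolding proper_colouring_def all_sum Pi_iff Ball_def verts_book_graph
    by (auto simp: edges_book_graph) metis+
qed

text \<open>Given page colours \<open>y\<close> and page guesses \<open>f\<close>, these are the spine colourings that are left to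
  the spines to guess.\<close>

definition surviving :: "nat \<Rightarrow> nat \<Rightarrow> nat \<Rightarrow> (nat \<Rightarrow> nat list \<Rightarrow> nat) \<Rightarrow> (nat \<Rightarrow> nat) \<Rightarrow> nat list set"
  where "surviving k q n f y =
    {x. proper_tuple k x \<and> set x \<subseteq> {..<q} \<and> (\<forall>b<n. y b \<notin> set x \<and> f b x \<noteq> y b)}"

text \<open>The part of spine i is saturated because its guess depends only on the other spines and
  the fixed pages: tuples that differ only in coordinate i draw the same guess, which is right for
  at most one of them.\<close>

lemma coverable_surviving:
  assumes win: "winning (book_graph k n) q g" and y: "\<And>b. b < n \<Longrightarrow> y b < q"
  shows "coverable k (surviving k q n
    (\<lambda>b x. g (Inr b) (restrict (case_sum (nth x) undefined) (Inl ` {..<k}))) y)"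
    (is "coverable k ?S")
proof -
  let ?c = "\<lambda>x. case_sum (nth x) y"
  let ?N = "\<lambda>i. nbhd (book_graph k n) (Inl i)"
  define Q where "Q i = {x \<in> ?S. g (Inl i) (restrict (?c x) (?N i)) = x ! i}" for i
  have "?S \<subseteq> (\<Union>i<k. Q i)"
  proof
    fix x assume x: "x \<in> ?S"
    then have len: "length x = k" and "distinct x" and xq: "set x \<subseteq> {..<q}"
      and yx: "\<And>b. b < n \<Longrightarrow> y b \<notin> set x"
      by (auto simp: surviving_def proper_tuple_def)
    have "proper_colouring (book_graph k n) q (?c x)"
      unfolding proper_colouring_book_graph
      using len \<open>distinct x\<close> xq yx y by (fastforce simp: nth_eq_iff_index_eq dest: nth_mem)
    then obtain v where v: "v \<in> {..<k} <+> {..<n}"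
        "g v (restrict (?c x) (nbhd (book_graph k n) v)) = ?c x v"
      using win unfolding winning_def verts_book_graph by blast
    show "x \<in> (\<Union>i<k. Q i)"
    proof (cases v)
      case (Inl i)
      with v x show ?thesis by (auto simp: Q_def)
    next
      case (Inr b)
      \<comment> \<open>A page sees only spines, so page colours may be replaced by
        \<open>undefined\<close>.\<close>
      have "restrict (?c x) (Inl ` {..<k}) = restrict (case_sum (nth x) undefined) (Inl ` {..<k})"
        by (rule restrict_ext) auto
      with v Inr x show ?thesis by (auto simp: surviving_def nbhd_book_graph_Inr)
    qed
  qed
  moreover have "saturated i (Q i)" if i: "i < k" for i
    unfolding saturated_def
  proof (rule inj_onI)
    fix x x' assume xx': "x \<in> Q i" "x' \<in> Q i" "del_coord i x = del_coord i x'"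
    then have len: "length x = k" "length x' = k"
      by (auto simp: Q_def surviving_def proper_tuple_def)
    with xx'(3) i have eq: "x ! j = x' ! j" if "j < k" "j \<noteq> i" for j
      using that by (simp add: del_coord_eq_iff)
    have "restrict (?c x) (?N i) = restrict (?c x') (?N i)"
      using eq by (intro restrict_ext) (auto simp: nbhd_book_graph_Inl[OF i], metis)
    then have "x ! i = x' ! i" using xx'(1,2) by (simp add: Q_def)
    with eq len show "x = x'" by (metis nth_equalityI)
  qed
  ultimately show ?thesis unfolding coverable_iff by blast
qed

text \<open>Every spine sees the page colours y, hence knows the cover chosen for y. Spine i guesses
  the only i-th coordinate that completes the colours of the other spines to a tuple in part
  i.\<close>

lemma winning_book_graphI:
  assumes q: "0 < q" and cov: "\<And>y. (\<And>b. b < n \<Longrightarrow> y b < q) \<Longrightarrow> coverable k (surviving k q n f y)"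
  shows "\<exists>g. winning (book_graph k n) q g"
proof -
  have "\<exists>Q. (\<forall>b<n. y b < q) \<longrightarrow>
      surviving k q n f y = (\<Union>i<k. Q i) \<and> (\<forall>i<k. saturated i (Q i))" for y
    using cov[of y] unfolding coverable_def by metis
  then obtain Q where Q: "\<And>y. (\<forall>b<n. y b < q) \<Longrightarrow>
      surviving k q n f y = (\<Union>i<k. Q y i) \<and> (\<forall>i<k. saturated i (Q y i))"
    by metis
  \<comment> \<open>What a spine sees and the whole colouring have the same image under
    \<open>pages\<close>, so all spines use the same cover.\<close>
  define pages where "pages h = restrict (\<lambda>b. h (Inr b)) {..<n}" for h :: "nat + nat \<Rightarrow> nat"
  define cand where "cand h i = {x ! i |x. x \<in> Q (pages h) i \<and> x ! i < q \<and> (\<forall>j<k. j \<noteq> i \<longrightarrow> x ! j = h (Inl j))}"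
    for h :: "nat + nat \<Rightarrow> nat" and i
  \<comment> \<open>A strategy must answer below q on every input, hence the default 0. Replacing
    values of f outside the range loses nothing, as page colours are below q.\<close>
  define g where "g v h = (case v of
      Inl i \<Rightarrow> if cand h i = {} then 0 else (SOME a. a \<in> cand h i)
    | Inr b \<Rightarrow> let a = f b (map (\<lambda>i. h (Inl i)) [0..<k]) in if a < q then a else 0)"
    for v and h :: "nat + nat \<Rightarrow> nat"
  have cand: "(SOME a. a \<in> cand h i) \<in> cand h i" if "cand h i \<noteq> {}" for h i
    using that by (simp add: some_in_eq)
  have cand_less: "a < q" if "a \<in> cand h i" for a h i
    using that by (auto simp: cand_def)
  have "g v h < q" for v h
    using q cand_less[OF cand] by (auto simp: g_def Let_def split: sum.splits)
  then have "strategy (book_graph k n) q g" by (simp add: strategy_def)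
  moreover have "\<exists>v\<in>verts (book_graph k n). g v (restrict c (nbhd (book_graph k n) v)) = c v"
    if c: "proper_colouring (book_graph k n) q c" for c
  proof -
    define x y where "x = map (\<lambda>i. c (Inl i)) [0..<k]" and "y = pages c"
    have x: "proper_tuple k x" "set x \<subseteq> {..<q}" "\<And>i. i < k \<Longrightarrow> x ! i = c (Inl i)"
      using c by (auto simp: x_def proper_tuple_def proper_colouring_book_graph distinct_map intro!: inj_onI) metis
    have y: "\<And>b. b < n \<Longrightarrow> y b = c (Inr b)" by (simp add: y_def pages_def)
    have yq: "\<forall>b<n. y b < q" using c y by (simp add: proper_colouring_book_graph)
    have yx: "\<forall>b<n. y b \<notin> set x"
      using c y by (auto simp: proper_colouring_book_graph x_def) metis
    show ?thesis
    proof (cases "x \<in> surviving k q n f y")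
      case False
      then obtain b where b: "b < n" "f b x = y b" using x yx by (auto simp: surviving_def)
      have "map (\<lambda>i. restrict c (Inl ` {..<k}) (Inl i)) [0..<k] = x" by (auto simp: x_def)
      then have "g (Inr b) (restrict c (nbhd (book_graph k n) (Inr b))) = c (Inr b)"
        using b y[OF b(1)] yq by (auto simp: g_def nbhd_book_graph_Inr)
      with b(1) show ?thesis by (auto simp: verts_book_graph)
    next
      case True
      then obtain i where i: "i < k" "x \<in> Q y i" using Q[OF yq] by auto
      define h where "h = restrict c (nbhd (book_graph k n) (Inl i))"
      have h: "pages h = y" "\<And>j. j < k \<Longrightarrow> j \<noteq> i \<Longrightarrow> h (Inl j) = x ! j"
        using i(1) x(3) by (auto simp: h_def pages_def y_def nbhd_book_graph_Inl restrict_def fun_eq_iff)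
      have "x ! i < q" using c x(3) i(1) by (simp add: proper_colouring_book_graph)
      then have "x ! i \<in> cand h i" using i h by (auto simp: cand_def)
      moreover have "a = x ! i" if a: "a \<in> cand h i" for a
      proof -
        obtain z where z: "a = z ! i" "z \<in> Q y i" "\<forall>j<k. j \<noteq> i \<longrightarrow> z ! j = h (Inl j)"
          using a h(1) by (auto simp: cand_def)
        have "z \<in> surviving k q n f y" using Q[OF yq] z(2) i(1) by auto
        then have "length z = k" by (simp add: surviving_def proper_tuple_def)
        with z(3) x(1) h(2) i(1) have "del_coord i z = del_coord i x"
          by (simp add: del_coord_eq_iff proper_tuple_def)
        moreover have "inj_on (del_coord i) (Q y i)" using Q[OF yq] i(1) by (simp add: saturated_def)
        ultimately have "z = x" using z(2) i(2) by (simp add: inj_on_eq_iff)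
        with z(1) show ?thesis by simp
      qed
      ultimately have "cand h i = {x ! i}" by blast
      then have "g (Inl i) h = x ! i" by (simp add: g_def)
      with i(1) x(3) show ?thesis by (auto simp: verts_book_graph h_def)
    qed
  qed
  ultimately show ?thesis unfolding winning_def by blast
qed

lemma not_winning_book_graph:
  assumes P: "configuration k P" "finite P" "\<not> coverable k P" "supp P \<subseteq> {..<q}"
    and less: "card P + card (supp P) < q"
  shows "\<not> winning (book_graph k n) q g"
proof
  assume win: "winning (book_graph k n) q g"
  define f where "f b x = g (Inr b) (restrict (case_sum (nth x) undefined) (Inl ` {..<k}))" for b x
  have "finite (supp P)" using P(4) finite_subset by blast
  \<comment> \<open>Pages do not see each other, so a safe colour can be found for each page
    separately.\<close>
  have "\<exists>a<q. a \<notin> supp P \<union> f b ` P" for b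
  proof (rule ccontr)
    assume "\<not> ?thesis"
    then have "{..<q} \<subseteq> supp P \<union> f b ` P" by blast
    then have "card {..<q} \<le> card (supp P \<union> f b ` P)"
      using \<open>finite (supp P)\<close> P(2) by (intro card_mono) auto
    also have "\<dots> \<le> card (supp P) + card P"
      using card_Un_le[of "supp P" "f b ` P"] card_image_le[OF P(2), of "f b"] by linarith
    finally show False using less by simp
  qed
  then obtain y where y: "\<And>b. y b < q" "\<And>b. y b \<notin> supp P \<union> f b ` P" by metis
  have "P \<subseteq> surviving k q n f y"
  proof
    fix x assume x: "x \<in> P"
    then have "f b x \<noteq> y b" for b by (metis UnI2 imageI y(2))
    with x P(1,4) y(2) show "x \<in> surviving k q n f y"
      by (auto simp: surviving_def configuration_def supp_def)
  qed
  moreover have "coverable k (surviving k q n f y)"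
    unfolding f_def using coverable_surviving[OF win, of y] y(1) by simp
  ultimately show False using coverable_subset P(3) by blast
qed

section \<open>Choosing the guesses of the pages\<close>

text \<open>Double counting of the pairs (f, P) with \<open>R f P\<close>: for f uniform on F each P
  is hit with probability at least p, and some f does at least as well as the average.\<close>

lemma ex_ge_average:
  fixes p :: real
  assumes fin: "finite X" "finite F" "F \<noteq> {}"
    and p: "\<And>P. P \<in> X \<Longrightarrow> p * card F \<le> card {f \<in> F. R f P}"
  shows "\<exists>f\<in>F. p * card X \<le> card {P \<in> X. R f P}"
proof (rule ccontr)
  assume "\<not> ?thesis"
  then have "(\<Sum>f\<in>F. real (card {P \<in> X. R f P})) < (\<Sum>f\<in>F. p * card X)"
    using fin by (intro sum_strict_mono) auto
  also have "\<dots> = (\<Sum>P\<in>X. p * card F)" by simp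
  also have "\<dots> \<le> (\<Sum>P\<in>X. real (card {f \<in> F. R f P}))" by (rule sum_mono) (rule p)
  also have "\<dots> = (\<Sum>f\<in>F. real (card {P \<in> X. R f P}))"
    using sum_multicount_gen[of F X R "\<lambda>P. card {f \<in> F. R f P}"] fin by (simp flip: of_nat_sum)
  finally show False by simp
qed

text \<open>Instead of n independent random choices, each new f is the one that
  \<open>ex_ge_average\<close> gives for the elements not yet hit, so at most a fraction 1 - p of
  them remains.\<close>

lemma ex_greedy_sequence:
  fixes p :: real
  assumes fin: "finite X" "finite F" "F \<noteq> {}" and "p \<le> 1"
    and p: "\<And>P. P \<in> X \<Longrightarrow> p * card F \<le> card {f \<in> F. R f P}"
  shows "\<exists>f. (\<forall>b<n. f b \<in> F) \<and> card {P \<in> X. \<forall>b<n. \<not> R (f b) P} \<le> card X * (1 - p) ^ n"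
proof (induction n)
  case 0
  then show ?case by simp
next
  case (Suc n)
  then obtain f where f: "\<forall>b<n. f b \<in> F" "card {P \<in> X. \<forall>b<n. \<not> R (f b) P} \<le> card X * (1 - p) ^ n"
    by blast
  define Y where "Y = {P \<in> X. \<forall>b<n. \<not> R (f b) P}"
  have Y: "finite Y" "Y \<subseteq> X" using fin by (auto simp: Y_def)
  obtain f' where f': "f' \<in> F" "p * card Y \<le> card {P \<in> Y. R f' P}"
    using ex_ge_average[OF Y(1) fin(2,3), of p R] p Y(2) by blast
  have eq: "{P \<in> X. \<forall>b<Suc n. \<not> R ((f(n := f')) b) P} = Y - {P \<in> Y. R f' P}"
    by (auto simp: Y_def less_Suc_eq)
  have "real (card (Y - {P \<in> Y. R f' P})) = real (card Y) - real (card {P \<in> Y. R f' P})"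
    using Y(1) by (subst card_Diff_subset) (auto simp: of_nat_diff card_mono)
  also have "\<dots> \<le> card Y * (1 - p)" using f'(2) by (simp add: algebra_simps)
  also have "\<dots> \<le> card X * (1 - p) ^ n * (1 - p)"
    using f(2) \<open>p \<le> 1\<close> unfolding Y_def by (intro mult_right_mono) auto
  finally show ?case
    using f(1) f'(1) by (intro exI[of _ "f(n := f')"]) (auto simp only: eq, auto simp: less_Suc_eq mult_ac)
qed

text \<open>At most q - s colours lie outside \<open>supp P\<close> and each guess has q - k
  options, so a random page excludes P with probability at least
  \<open>p = 1 / (q - k) ^ (q - s)\<close>. The bound on n makes
  \<open>2 ^ card X * exp (- p * n)\<close> at most 1.\<close>

lemma winning_book_graph_large:
  assumes "k < q"
    and bounds: "\<And>P. \<lbrakk>configuration k P; finite P; \<not> coverable k P; supp P \<subseteq> {..<q}\<rbrakk>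
      \<Longrightarrow> s \<le> card (supp P) \<and> q \<le> card P + card (supp P)"
    and n: "real (card {x. proper_tuple k x \<and> set x \<subseteq> {..<q}}) * ln 2 * real (q - k) ^ (q - s) \<le> real n"
  shows "\<exists>g. winning (book_graph k n) q g"
proof -
  define X where "X = {x. proper_tuple k x \<and> set x \<subseteq> {..<q}}"
  \<comment> \<open>No page guesses a colour that it sees on a spine; this leaves q - k options
    instead of q.\<close>
  define F where "F = (\<Pi>\<^sub>E x\<in>X. {..<q} - set x)"
  define \<P> where "\<P> = {P. P \<subseteq> X \<and> \<not> coverable k P}"
  \<comment> \<open>Under \<open>R f P\<close> every possible page colour occurs on a spine for some
    x in P or is guessed on some x in P, so P cannot survive as a whole.\<close>
  define R where "R f P \<longleftrightarrow> {..<q} \<subseteq> supp P \<union> f ` P" for f :: "nat list \<Rightarrow> nat" and P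
  define d where "d = q - k"
  define p where "p = 1 / real d ^ (q - s)"
  have d: "0 < d" using \<open>k < q\<close> by (simp add: d_def)
  have p: "0 < p" "p \<le> 1" using d by (auto simp: p_def)
  have finX: "finite X"
    by (rule finite_subset[OF _ finite_lists_length_eq[of "{..<q}" k]]) (auto simp: X_def proper_tuple_def)
  have finP: "finite \<P>" unfolding \<P>_def by (rule finite_subset[of _ "Pow X"]) (use finX in auto)
  have finF: "finite F" unfolding F_def using finX by (intro finite_PiE) auto
  have card_avoid: "card ({..<q} - set x) = d" if "x \<in> X" for x
    using that by (auto simp: X_def proper_tuple_def d_def card_Diff_subset distinct_card)
  have cF: "card F = d ^ card X"
    unfolding F_def using finX card_avoid by (simp add: card_PiE)
  have prob: "p * card F \<le> card {f \<in> F. R f P}" if P: "P \<in> \<P>" for P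
  proof -
    have PX: "P \<subseteq> X" and "\<not> coverable k P" using P by (auto simp: \<P>_def)
    have finP: "finite P" using PX finX by (rule finite_subset)
    have supp: "supp P \<subseteq> {..<q}" using PX by (auto simp: X_def supp_def)
    have "configuration k P" using PX by (auto simp: configuration_def X_def)
    with bounds finP supp \<open>\<not> coverable k P\<close>
    have b: "s \<le> card (supp P)" "q \<le> card P + card (supp P)" by blast+
    define D where "D = {..<q} - supp P"
    have cD: "card D = q - card (supp P)"
      using supp by (simp add: D_def card_Diff_subset finite_subset[OF supp])
    with b have "card D \<le> card P" by simp
    then obtain h where h: "h ` D \<subseteq> P" "inj_on h D"
      using card_le_inj[of D P] finP by (auto simp: D_def)
    \<comment> \<open>Guessing \<open>a\<close> on \<open>h a\<close> for every \<open>a \<in> D\<close> is enough to exclude \<open>P\<close>.\<close>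
    define T where "T = h ` D"
    define G where "G = (\<Pi>\<^sub>E x\<in>X. if x \<in> T then {inv_into D h x} else {..<q} - set x)"
    have TX: "T \<subseteq> X" using h PX by (auto simp: T_def)
    have cT: "card T = card D" using h by (simp add: T_def card_image)
    have "card G = (\<Prod>x\<in>X. if x \<in> T then 1 else d)"
      unfolding G_def using finX card_avoid by (auto simp: card_PiE intro!: prod.cong)
    also have "\<dots> = d ^ card (X - T)"
      using finX by (subst prod.If_cases) (auto simp: Diff_eq)
    also have "card (X - T) = card X - card D"
      using TX finX cT by (simp add: card_Diff_subset finite_subset[OF TX])
    finally have cG: "card G = d ^ (card X - card D)" .
    have "G \<subseteq> {f \<in> F. R f P}"
    proof (intro subsetI CollectI conjI)
      fix f assume f: "f \<in> G"
      have hD: "f (h a) = a" if "a \<in> D" for a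
      proof -
        have "h a \<in> T" "h a \<in> X" using that TX by (auto simp: T_def)
        with f have "f (h a) = inv_into D h (h a)" by (auto simp: G_def dest!: PiE_mem)
        with h that show ?thesis by simp
      qed
      then show "R f P" using h(1) by (force simp: R_def D_def)
      show "f \<in> F"
        unfolding F_def
      proof (rule PiE_I)
        fix x assume x: "x \<in> X"
        show "f x \<in> {..<q} - set x"
        proof (cases "x \<in> T")
          case True
          then obtain a where "x = h a" "a \<in> D" by (auto simp: T_def)
          \<comment> \<open>The prescribed guess a lies outside \<open>supp P\<close>, hence is not
            an entry of the tuple \<open>h a\<close>.\<close>
          with hD h(1) show ?thesis by (auto simp: D_def supp_def)
        next
          case False
          with f x show ?thesis by (auto simp: G_def dest!: PiE_mem)
        qed
      qed (use f in \<open>auto simp: G_def\<close>)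
    qed
    then have "card G \<le> card {f \<in> F. R f P}" using finF by (intro card_mono) auto
    moreover have "p * card F \<le> card G"
    proof -
      have "card D \<le> card X" using cT card_mono[OF finX TX] by simp
      then have "real d ^ card X = real d ^ (card X - card D) * real d ^ card D"
        by (simp flip: power_add)
      also have "\<dots> \<le> real d ^ (card X - card D) * real d ^ (q - s)"
        using d cD b(1) by (intro mult_left_mono power_increasing) auto
      finally show ?thesis using d by (simp add: p_def cF cG field_simps)
    qed
    ultimately show ?thesis by linarith
  qed
  have "F \<noteq> {}" using cF d by auto
  then obtain f
    where f: "real (card {P \<in> \<P>. \<forall>b<n. \<not> R (f b) P}) \<le> card \<P> * (1 - p) ^ n"
    using ex_greedy_sequence[OF finP finF _ p(2), where R = R and n = n] prob by blast
  \<comment> \<open>Leaving out the empty configuration makes the final bound strict.\<close>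
  have "coverable k {}" unfolding coverable_iff by (auto simp: saturated_def intro: exI[of _ "\<lambda>_. {}"])
  then have "\<P> \<subset> Pow X" by (auto simp: \<P>_def)
  then have "card \<P> < 2 ^ card X"
    using psubset_card_mono[of "Pow X" \<P>] finX by (simp add: card_Pow)
  then have lt: "real (card \<P>) < 2 ^ card X" by (metis of_nat_less_iff of_nat_numeral of_nat_power)
  have "real (card \<P>) * (1 - p) ^ n \<le> card \<P> * exp (- p) ^ n"
    using p exp_ge_add_one_self[of "- p"] by (intro mult_left_mono power_mono) auto
  also have "\<dots> < 2 ^ card X * exp (- p) ^ n" using lt by (intro mult_strict_right_mono) auto
  also have "\<dots> = exp (card X * ln 2 - p * n)"
    using exp_of_nat_mult[of "card X" "ln 2 :: real"] exp_of_nat2_mult[of p n]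
    by (simp add: exp_diff exp_minus field_simps)
  also have "\<dots> \<le> 1"
  proof -
    have "card X * ln 2 * real d ^ (q - s) \<le> n" using n by (simp add: X_def d_def)
    then show ?thesis using d by (simp add: p_def field_simps)
  qed
  finally have "real (card {P \<in> \<P>. \<forall>b<n. \<not> R (f b) P}) < 1" using f by linarith
  then have "{P \<in> \<P>. \<forall>b<n. \<not> R (f b) P} = {}" using finP by simp
  then have R: "\<exists>b<n. R (f b) P" if "P \<in> \<P>" for P using that by blast
  show ?thesis
  proof (rule winning_book_graphI)
    fix y assume y: "\<And>b. b < n \<Longrightarrow> y b < q"
    show "coverable k (surviving k q n f y)"
    proof (rule ccontr)
      assume "\<not> ?thesis"
      then have "surviving k q n f y \<in> \<P>" by (auto simp: \<P>_def surviving_def X_def)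
      then obtain b where b: "b < n" "{..<q} \<subseteq> supp (surviving k q n f y) \<union> f b ` surviving k q n f y"
        using R unfolding R_def by blast
      \<comment> \<open>The colour \<open>y b\<close> is below q, yet it is neither in the support
        of the surviving set nor guessed on it.\<close>
      with y[of b] show False by (force simp: surviving_def supp_def)
    qed
  qed (use \<open>k < q\<close> in simp)
qed

section \<open>The case of two spines\<close>

lemma HGP_book_graph_le: "HGP (book_graph 2 n) \<le> 11"
proof -
  have ne: "verts (book_graph 2 n) \<noteq> {}" by (simp add: verts_book_graph Plus_def lessThan_empty_iff)
  obtain g where g: "winning (book_graph 2 n) (HGP (book_graph 2 n)) g"
    using winning_HGP[OF fin_simple_graph_book_graph ne] by blast
  show ?thesis
  proof (rule ccontr)
    assume "\<not> ?thesis"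
    \<comment> \<open>The configuration \<open>K23\<close> uses only the colours 0 to 4, available
      for every q > 11, and 6 + 5 = 11 < q.\<close>
    then have "11 < HGP (book_graph 2 n)" by simp
    with not_winning_book_graph[OF configuration_K23 finite_K23 not_coverable_K23, of "HGP (book_graph 2 n)"] g
    show False by (auto simp: card_K23 supp_K23)
  qed
qed

text \<open>Here q = 11, k = 2 and s = 4: there are 11 * 10 = 110 proper pairs, 9 = 11 - 2 options
  per guess, and at most 7 = 11 - 4 colours to guess.\<close>

lemma HGP_book_graph_ge:
  assumes "110 * ln 2 * 9 ^ 7 \<le> real n"
  shows "11 \<le> HGP (book_graph 2 n)"
proof -
  have "card {x. proper_tuple 2 x \<and> set x \<subseteq> {..<11}} = 110"
    using card_lists_distinct_length_eq[of "{..<11::nat}" 2]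
    by (simp add: proper_tuple_def numeral_eq_Suc atLeastAtMostSuc_conv)
  then have "\<exists>g. winning (book_graph 2 n) 11 g"
    using assms not_coverable_2_bounds
    by (intro winning_book_graph_large[where s = 4]) auto
  then show ?thesis using winning_le_HGP[OF fin_simple_graph_book_graph] by blast
qed

lemma ceiling_ln_2: "\<lceil>110 * ln (2::real) * 9 ^ 7\<rceil> = 364683163"
proof -
  \<comment> \<open>The order 12 makes the enclosure of ln 2 fit into an interval of length
    \<open>1 / (110 * 9 ^ 7)\<close> on which the ceiling is constant.\<close>
  have "ln 2 \<in> {364683162 / (110 * 9 ^ 7) <.. (364683163 / (110 * 9 ^ 7) :: real)}"
    using ln_approx_bounds[of 2 12] by (simp add: eval_nat_numeral)
  then show ?thesis by (intro ceiling_unique) auto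
qed

theorem theorem1p2:
  shows "C 2 = 11
    \<and> (\<forall>n\<ge>1. HGP (book_graph 2 n) \<le> 11)
    \<and> \<lceil>110 * ln (2::real) * 9 ^ 7\<rceil> = 364683163
    \<and> (\<exists>n0::nat. int n0 \<le> \<lceil>110 * ln (2::real) * 9 ^ 7\<rceil>
           \<and> (\<forall>n\<ge>n0. HGP (book_graph 2 n) = 11))
    \<and> (\<lambda>n. HGP (book_graph 2 n)) \<longlonglongrightarrow> 11
    \<and> (SUP n\<in>{1..}. HGP (book_graph 2 n)) = 11"
proof -
  let ?n0 = "364683163 :: nat"
  have eq: "HGP (book_graph 2 n) = 11" if "n \<ge> ?n0" for n
  proof (rule antisym[OF HGP_book_graph_le HGP_book_graph_ge])
    have "110 * ln (2::real) * 9 ^ 7 \<le> 364683163"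
      using le_of_int_ceiling[of "110 * ln (2::real) * 9 ^ 7"] unfolding ceiling_ln_2 by simp
    with that show "110 * ln 2 * 9 ^ 7 \<le> real n" by linarith
  qed
  have "(\<lambda>n. HGP (book_graph 2 n)) \<longlonglongrightarrow> 11"
    by (rule tendsto_eventually) (use eq in \<open>auto simp: eventually_sequentially\<close>)
  moreover have "(SUP n\<in>{1..}. HGP (book_graph 2 n)) = 11"
  proof (rule cSup_eq_maximum)
    show "11 \<in> (\<lambda>n. HGP (book_graph 2 n)) ` {1..}" using eq[of ?n0] by (intro image_eqI[of _ _ ?n0]) auto
  qed (auto simp: HGP_book_graph_le)
  ultimately show ?thesis
    using C_2 HGP_book_graph_le ceiling_ln_2 eq by (auto intro!: exI[of _ ?n0])
qed

end
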